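(* Let $X_n$, $n\ge1$, be a stationary sequence of centered real random variables that is L-weakly dependent with coefficients $\gamma_k$, $k\geq 1$, and suppose there exists $c>0$ such that $|X_n|\le c$ almost surely for every $n\ge1$. Let $S_n=X_1+\cdots+X_n$ and assume that $\frac1n\mathbb{E}S_n^2\to\sigma^2$ as $n\to\infty$ for some $\sigma^2\in(0,\infty)$. Assume that $v(n)=\sum_{k=n}^\infty\gamma_k$ satisfies $v(n)=O(\rho^n)$ for some $\rho\in(0,1)$. Then $\frac1nS_n\to0$ almost surely.
   Context: Stationary means strictly stationary. L-weak dependence: real random variables $X_n$, $n\ge1$, are L-weakly dependent with nonnegative coefficients $\gamma_k$, $k\ge1$, if $\sum_{k\ge1}\gamma_k<\infty$ and for all disjoint finite subsets $I,J\subset\{1,2,\ldots\}$ and all real valued Lipschitz functions $f:\mathbb{R}^I\to\mathbb{R}$, $g:\mathbb{R}^J\to\mathbb{R}$, the covariance below is well defined and $$|\mathrm{Cov}(f(X_i,i\in I),g(X_j,j\in J))|\le \|f\|_L\|g\|_L\sum_{i\in I}\sum_{j\in J}\gamma_{|j-i|},$$ where $\|f\|_L=\sup_{x\neq y}\frac{|f(x)-f(y)|}{|x-y|}$ and $|x-y|=\sum_i|x_i-y_i|$ is the $\ell^1$ distance. *)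

theory Defs
  imports "HOL-Probability.Probability" "HOL-Library.Landau_Symbols"
begin

text \<open>
  For a finite index set \<open>I\<close>, the space of real vectors indexed by \<open>I\<close> is represented by the
  extensional functions \<open>I \<rightarrow>\<^sub>E UNIV\<close>. Processes are functions \<open>X :: nat \<Rightarrow> 'a \<Rightarrow> real\<close> of which
  only the values at indices \<open>n \<ge> 1\<close> are relevant.
\<close>

definition l1_dist :: "nat set \<Rightarrow> (nat \<Rightarrow> real) \<Rightarrow> (nat \<Rightarrow> real) \<Rightarrow> real" where
  "l1_dist I x y = (\<Sum>i\<in>I. \<bar>x i - y i\<bar>)"

definition l1_lipschitz :: "nat set \<Rightarrow> ((nat \<Rightarrow> real) \<Rightarrow> real) \<Rightarrow> bool" where
  "l1_lipschitz I f \<longleftrightarrow>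
     (\<exists>L. \<forall>x \<in> I \<rightarrow>\<^sub>E UNIV. \<forall>y \<in> I \<rightarrow>\<^sub>E UNIV. \<bar>f x - f y\<bar> \<le> L * l1_dist I x y)"

text \<open>
  The quotients are nonnegative, so inserting \<open>0\<close> only matters for \<open>I = {}\<close>, where there are no
  two distinct points and the supremum is read as \<open>0\<close>.
\<close>

definition l1_lip_norm :: "nat set \<Rightarrow> ((nat \<Rightarrow> real) \<Rightarrow> real) \<Rightarrow> real" where
  "l1_lip_norm I f =
     Sup (insert 0 {\<bar>f x - f y\<bar> / l1_dist I x y | x y.
                      x \<in> I \<rightarrow>\<^sub>E UNIV \<and> y \<in> I \<rightarrow>\<^sub>E UNIV \<and> x \<noteq> y})"

definition cov_well_defined :: "'a measure \<Rightarrow> ('a \<Rightarrow> real) \<Rightarrow> ('a \<Rightarrow> real) \<Rightarrow> bool" where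
  "cov_well_defined M U V \<longleftrightarrow>
     integrable M U \<and> integrable M V \<and> integrable M (\<lambda>\<omega>. U \<omega> * V \<omega>)"

definition cov :: "'a measure \<Rightarrow> ('a \<Rightarrow> real) \<Rightarrow> ('a \<Rightarrow> real) \<Rightarrow> real" where
  "cov M U V =
     prob_space.expectation M
       (\<lambda>\<omega>. (U \<omega> - prob_space.expectation M U) * (V \<omega> - prob_space.expectation M V))"

text \<open>Indices in disjoint sets are distinct, so \<open>\<gamma> 0\<close> never occurs in the double sum.\<close>

definition L_weakly_dependent :: "'a measure \<Rightarrow> (nat \<Rightarrow> 'a \<Rightarrow> real) \<Rightarrow> (nat \<Rightarrow> real) \<Rightarrow> bool" where
  "L_weakly_dependent M X \<gamma> \<longleftrightarrow>
     (\<forall>k\<ge>1. 0 \<le> \<gamma> k) \<and> \<gamma> summable_on {1..} \<and>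
     (\<forall>I J f g. finite I \<longrightarrow> finite J \<longrightarrow> I \<subseteq> {1..} \<longrightarrow> J \<subseteq> {1..} \<longrightarrow> I \<inter> J = {} \<longrightarrow>
        l1_lipschitz I f \<longrightarrow> l1_lipschitz J g \<longrightarrow>
        (let U = (\<lambda>\<omega>. f (\<lambda>i\<in>I. X i \<omega>)); V = (\<lambda>\<omega>. g (\<lambda>j\<in>J. X j \<omega>)) in
           cov_well_defined M U V \<and>
           \<bar>cov M U V\<bar> \<le> l1_lip_norm I f * l1_lip_norm J g *
             (\<Sum>i\<in>I. \<Sum>j\<in>J. \<gamma> (nat \<bar>int j - int i\<bar>))))"

text \<open>Strict stationarity: all finite-dimensional distributions are shift invariant.\<close>

definition strictly_stationary :: "'a measure \<Rightarrow> (nat \<Rightarrow> 'a \<Rightarrow> real) \<Rightarrow> bool" where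
  "strictly_stationary M X \<longleftrightarrow>
     (\<forall>J h. finite J \<longrightarrow> J \<subseteq> {1..} \<longrightarrow>
        distr M (\<Pi>\<^sub>M j\<in>J. borel) (\<lambda>\<omega>. \<lambda>j\<in>J. X (j + h) \<omega>) =
        distr M (\<Pi>\<^sub>M j\<in>J. borel) (\<lambda>\<omega>. \<lambda>j\<in>J. X j \<omega>))"

end

theory Submission
  imports Defs "HOL-Library.Discrete_Functions"
begin

text \<open>
  The convergence of \<open>E (S n)\<^sup>2 / n\<close> alone gives \<open>E (S n)\<^sup>2 \<le> K n\<close>, so the series
  \<open>\<Sum>m. E (S (m\<^sup>2) / m\<^sup>2)\<^sup>2\<close> converges and \<open>S (m\<^sup>2) / m\<^sup>2\<close> tends to \<open>0\<close> almost surely.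
  The terms are bounded, so \<open>S\<close> varies by at most \<open>2 c m\<close> between \<open>m\<^sup>2\<close> and
  \<open>(m + 1)\<^sup>2\<close>, which is negligible against \<open>m\<^sup>2\<close>.
\<close>

lemma filterlim_floor_sqrt: "filterlim floor_sqrt at_top at_top"
  unfolding filterlim_at_top
proof
  fix m :: nat
  show "\<forall>\<^sub>F n in sequentially. m \<le> floor_sqrt n"
    using eventually_ge_at_top[of "m\<^sup>2"] by eventually_elim (simp add: le_floor_sqrt_iff)
qed

text \<open>Deterministic interpolation, to be applied to one sample path at a time: between
  consecutive squares only \<open>2 * m\<close> bounded terms are added, and dividing by at least
  \<open>m\<^sup>2\<close> makes their share O(1/m).\<close>

lemma averages_tendsto_0_from_squares:
  fixes x :: "nat \<Rightarrow> real"
  assumes bound: "\<And>i. i \<ge> 1 \<Longrightarrow> \<bar>x i\<bar> \<le> c"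
    and squares: "(\<lambda>m. (\<Sum>i=1..m\<^sup>2. x i) / real (m\<^sup>2)) \<longlonglongrightarrow> 0"
  shows "(\<lambda>n. (\<Sum>i=1..n. x i) / real n) \<longlonglongrightarrow> 0"
proof (rule Lim_null_comparison)
  \<comment> \<open>The second summand is the cost of at most \<open>2 * m\<close> extra terms of
    size at most \<open>c\<close>, divided by \<open>m\<^sup>2\<close>.\<close>
  define b where "b m = \<bar>(\<Sum>i=1..m\<^sup>2. x i) / real (m\<^sup>2)\<bar> + 2 * c / real m" for m :: nat
  have "(\<lambda>m. 2 * c / real m) \<longlonglongrightarrow> 0"
    by (rule lim_const_over_n)
  then have "b \<longlonglongrightarrow> 0"
    unfolding b_def using tendsto_add[OF tendsto_rabs[OF squares]] by simp
  then show "(\<lambda>n. b (floor_sqrt n)) \<longlonglongrightarrow> 0"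
    using filterlim_floor_sqrt by (rule filterlim_compose)
  show "\<forall>\<^sub>F n in sequentially. norm ((\<Sum>i=1..n. x i) / real n) \<le> b (floor_sqrt n)"
    using eventually_ge_at_top[of 1]
  proof eventually_elim
    case (elim n)
    define m where "m = floor_sqrt n"
    have m: "m \<ge> 1" "m\<^sup>2 \<le> n"
      using elim by (simp_all add: m_def le_floor_sqrt_iff)
    have "n < (m + 1)\<^sup>2"
      unfolding m_def using Suc_floor_sqrt_power2_gt by simp
    then have gap: "n - m\<^sup>2 \<le> 2 * m"
      by (simp add: power2_eq_square algebra_simps)
    have c: "c \<ge> 0"
      using bound[of 1] by simp
    have "(\<Sum>i=1..n. x i) = (\<Sum>i=1..m\<^sup>2. x i) + (\<Sum>i=m\<^sup>2+1..n. x i)"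
      using sum.ub_add_nat[of 1 "m\<^sup>2" x "n - m\<^sup>2"] m by simp
    also have "\<bar>\<dots>\<bar> \<le> \<bar>\<Sum>i=1..m\<^sup>2. x i\<bar> + \<bar>\<Sum>i=m\<^sup>2+1..n. x i\<bar>"
      by (rule abs_triangle_ineq)
    also have "\<bar>\<Sum>i=m\<^sup>2+1..n. x i\<bar> \<le> (\<Sum>i=m\<^sup>2+1..n. c)"
      by (rule order.trans[OF sum_abs sum_mono]) (simp add: bound)
    also have "\<dots> = real (n - m\<^sup>2) * c"
      by simp
    also have "\<dots> \<le> real (2 * m) * c"
      using gap c by (intro mult_right_mono) (simp_all only: of_nat_le_iff)
    \<comment> \<open>Besides enlarging the numerator, the denominator \<open>n\<close> is lowered
      to \<open>m\<^sup>2\<close>, which is positive because \<open>m \<ge> 1\<close>.\<close>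
    finally have "\<bar>\<Sum>i=1..n. x i\<bar> / real n \<le> (\<bar>\<Sum>i=1..m\<^sup>2. x i\<bar> + real (2 * m) * c) / real (m\<^sup>2)"
      using m c elim by (intro frac_le) (simp_all only: of_nat_le_iff, simp_all)
    also have "\<dots> = b m"
      using m by (simp add: b_def add_divide_distrib power2_eq_square)
    finally show ?case
      by (simp add: m_def)
  qed
qed

text \<open>By monotone convergence the random series of squares has finite integral, so it is
  finite almost everywhere, and the terms of a convergent series tend to 0.\<close>

lemma AE_tendsto_0_of_summable_second_moments:
  fixes Y :: "nat \<Rightarrow> 'a \<Rightarrow> real"
  assumes int: "\<And>m. integrable M (\<lambda>\<omega>. (Y m \<omega>)\<^sup>2)"
    and sm: "summable (\<lambda>m. \<integral>\<omega>. (Y m \<omega>)\<^sup>2 \<partial>M)"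
  shows "AE \<omega> in M. (\<lambda>m. Y m \<omega>) \<longlonglongrightarrow> 0"
proof -
  \<comment> \<open>Only the squares are known to be measurable, through their integrability;
    nothing is assumed about \<open>Y m\<close> itself.\<close>
  have [measurable]: "(\<lambda>\<omega>. (Y m \<omega>)\<^sup>2) \<in> borel_measurable M" for m
    using int by (rule borel_measurable_integrable)
  have "(\<integral>\<^sup>+\<omega>. (\<Sum>m. ennreal ((Y m \<omega>)\<^sup>2)) \<partial>M) = (\<Sum>m. \<integral>\<^sup>+\<omega>. ennreal ((Y m \<omega>)\<^sup>2) \<partial>M)"
    by (rule nn_integral_suminf) measurable
  also have "\<dots> = (\<Sum>m. ennreal (\<integral>\<omega>. (Y m \<omega>)\<^sup>2 \<partial>M))"
    by (simp add: nn_integral_eq_integral int)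
  also have "\<dots> \<noteq> \<infinity>"
    using sm by (simp add: suminf_ennreal2)
  finally have "AE \<omega> in M. (\<Sum>m. ennreal ((Y m \<omega>)\<^sup>2)) \<noteq> \<infinity>"
    by (intro nn_integral_PInf_AE) measurable
  then show ?thesis
  proof eventually_elim
    case (elim \<omega>)
    then have "summable (\<lambda>m. (Y m \<omega>)\<^sup>2)"
      by (intro summable_suminf_not_top) simp_all
    then have "(\<lambda>m. sqrt ((Y m \<omega>)\<^sup>2)) \<longlonglongrightarrow> sqrt 0"
      by (intro tendsto_real_sqrt summable_LIMSEQ_zero)
    then show ?case
      by (simp add: tendsto_rabs_zero_iff)
  qed
qed

theorem theorem10:
  fixes M :: "'a measure" and X :: "nat \<Rightarrow> 'a \<Rightarrow> real" and \<gamma> :: "nat \<Rightarrow> real"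
    and c \<sigma>2 \<rho> :: real and S :: "nat \<Rightarrow> 'a \<Rightarrow> real" and v :: "nat \<Rightarrow> real"
  defines "S \<equiv> \<lambda>n \<omega>. \<Sum>i=1..n. X i \<omega>"
    and "v \<equiv> \<lambda>n. \<Sum>\<^sub>\<infinity>k\<in>{n..}. \<gamma> k"
  assumes "prob_space M"
    and "\<And>n. n \<ge> 1 \<Longrightarrow> X n \<in> borel_measurable M"
    and "strictly_stationary M X"
    and "\<And>n. n \<ge> 1 \<Longrightarrow> prob_space.expectation M (X n) = 0"
    and "L_weakly_dependent M X \<gamma>"
    and "c > 0" and "\<And>n. n \<ge> 1 \<Longrightarrow> AE \<omega> in M. \<bar>X n \<omega>\<bar> \<le> c"
    and "\<sigma>2 > 0"
    and "(\<lambda>n. prob_space.expectation M (\<lambda>\<omega>. (S n \<omega>)\<^sup>2) / real n) \<longlonglongrightarrow> \<sigma>2"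
    and "0 < \<rho>" and "\<rho> < 1" and "v \<in> O(\<lambda>n. \<rho> ^ n)"
  shows "AE \<omega> in M. (\<lambda>n. S n \<omega> / real n) \<longlonglongrightarrow> 0"
proof -
  interpret prob_space M by fact
  note meas [measurable] = assms(4) and bound = assms(9)
  have S_meas [measurable]: "S n \<in> borel_measurable M" for n
    unfolding S_def by (intro borel_measurable_sum meas) simp
  \<comment> \<open>A countable union of null sets is null, so one exceptional set serves all
    indices.\<close>
  have AE_bound: "AE \<omega> in M. \<forall>i\<ge>1. \<bar>X i \<omega>\<bar> \<le> c"
    unfolding AE_all_countable using bound by auto
  have S_int: "integrable M (\<lambda>\<omega>. (S n \<omega>)\<^sup>2)" for n
  proof (rule integrable_const_bound)
    show "AE \<omega> in M. norm ((S n \<omega>)\<^sup>2) \<le> (real n * c)\<^sup>2"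
      using AE_bound
    proof eventually_elim
      case (elim \<omega>)
      have "\<bar>S n \<omega>\<bar> \<le> (\<Sum>i=1..n. c)"
        unfolding S_def using elim by (intro order.trans[OF sum_abs sum_mono]) simp
      then show ?case
        using power_mono[of "\<bar>S n \<omega>\<bar>" "real n * c" 2] by simp
    qed
  qed measurable
  \<comment> \<open>A convergent sequence is bounded. At \<open>n = 0\<close> the quotient is 0 by
    the convention for division by zero.\<close>
  obtain K where K: "\<And>n. \<bar>expectation (\<lambda>\<omega>. (S n \<omega>)\<^sup>2) / real n\<bar> \<le> K"
    using convergent_imp_Bseq[OF convergentI[OF assms(11)]] by (auto simp: Bseq_def)
  define Y where "Y m \<omega> = S (m\<^sup>2) \<omega> / real (m\<^sup>2)" for m \<omega>
  have Y_sq: "(Y m \<omega>)\<^sup>2 = (S (m\<^sup>2) \<omega>)\<^sup>2 / (real (m\<^sup>2))\<^sup>2" for m \<omega>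
    by (simp add: Y_def power_divide)
  have "AE \<omega> in M. (\<lambda>m. Y m \<omega>) \<longlonglongrightarrow> 0"
  proof (rule AE_tendsto_0_of_summable_second_moments)
    show "integrable M (\<lambda>\<omega>. (Y m \<omega>)\<^sup>2)" for m
      unfolding Y_sq by (intro integrable_divide S_int)
    show "summable (\<lambda>m. expectation (\<lambda>\<omega>. (Y m \<omega>)\<^sup>2))"
    proof (rule summable_comparison_test')
      show "summable (\<lambda>m. K * (1 / real m ^ 2))"
        by (intro summable_mult) (use inverse_power_summable[of 2] in \<open>simp add: field_simps\<close>)
      fix m :: nat
      \<comment> \<open>Of the two factors \<open>1 / m\<^sup>2\<close> in the second moment of
        \<open>Y m\<close>, one normalizes the moment of \<open>S (m\<^sup>2)\<close>, which
        \<open>K\<close> then bounds; the other is left to give a summable majorant. For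
        \<open>m = 0\<close> both sides are 0.\<close>
      have "norm (expectation (\<lambda>\<omega>. (Y m \<omega>)\<^sup>2))
          = \<bar>expectation (\<lambda>\<omega>. (S (m\<^sup>2) \<omega>)\<^sup>2) / real (m\<^sup>2)\<bar> * (1 / real m ^ 2)"
        unfolding Y_sq by (simp add: abs_divide power2_eq_square)
      also have "\<dots> \<le> K * (1 / real m ^ 2)"
        by (intro mult_right_mono K) simp
      finally show "norm (expectation (\<lambda>\<omega>. (Y m \<omega>)\<^sup>2)) \<le> K * (1 / real m ^ 2)" .
    qed
  qed
  then show ?thesis
    using AE_bound
  proof eventually_elim
    case (elim \<omega>)
    then show ?case
      unfolding S_def Y_def by (intro averages_tendsto_0_from_squares[of _ c]) auto
  qed
qed

end
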